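(* Let $x_1,x_2,x_3,\dots$ be indeterminates. For $n\ge 0$ put $m_n=\prod_{i=0}^{n} x_{i+1}^{\binom{n}{i}}$ (so $m_0=x_1$, $m_1=x_1x_2$, $m_2=x_1x_2^2x_3$, $m_3=x_1x_2^3x_3^3x_4,\dots$). Then, as formal power series, $$\sum_{\pi\in\mathfrak S(1243,2143)}\ \prod_{k\ge 1}x_k^{\tau_k(\pi)} \;=\; 1+\cfrac{m_0}{1-m_0-\cfrac{m_1}{1-m_1-\cfrac{m_2}{1-m_2-\cdots}}}.$$
   Context: A permutation $\pi$ (in one-line notation) avoids a pattern $\sigma$ if $\pi$ has no subsequence whose entries have the same relative order as $\sigma$. $\mathfrak S_n(R)$ denotes the permutations of $\{1,\dots,n\}$ avoiding every pattern in the set $R$, and $\mathfrak S(R)=\bigcup_{n\ge0}\mathfrak S_n(R)$ (including the empty permutation). For a permutation $\pi$ and $k\ge1$, $\tau_k(\pi)$ is the number of increasing subsequences of length $k$ in $\pi$; in particular $\tau_1(\pi)=|\pi|$ is the length. Every monomial $m_n$ contains $x_1$, so the continued fraction converges $x_1$-adically. *)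

theory Defs
  imports Main "HOL-Library.Poly_Mapping"
begin

definition is_perm :: "nat list \<Rightarrow> bool" where
  "is_perm \<pi> \<longleftrightarrow> distinct \<pi> \<and> set \<pi> = {1..length \<pi>}"

definition order_iso :: "nat list \<Rightarrow> nat list \<Rightarrow> bool" where
  "order_iso xs ys \<longleftrightarrow> length xs = length ys \<and>
     (\<forall>i<length xs. \<forall>j<length xs. (xs ! i < xs ! j) \<longleftrightarrow> (ys ! i < ys ! j))"

definition contains :: "nat list \<Rightarrow> nat list \<Rightarrow> bool" where
  "contains \<pi> \<sigma> \<longleftrightarrow> (\<exists>I. I \<subseteq> {..<length \<pi>} \<and> order_iso (nths \<pi> I) \<sigma>)"

definition avoids_all :: "nat list \<Rightarrow> nat list set \<Rightarrow> bool" where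
  "avoids_all \<pi> R \<longleftrightarrow> (\<forall>\<sigma>\<in>R. \<not> contains \<pi> \<sigma>)"

definition tau :: "nat \<Rightarrow> nat list \<Rightarrow> nat" where
  "tau k \<pi> = card {I. I \<subseteq> {..<length \<pi>} \<and> card I = k \<and> sorted_wrt (<) (nths \<pi> I)}"

text \<open>Monomials: finitely supported exponent vectors; index k stands for the variable x_k
  (index 0 is unused). A series is its coefficient function.\<close>
type_synonym mono = "nat \<Rightarrow>\<^sub>0 nat"
type_synonym mps = "mono \<Rightarrow> int"

definition mps_one :: mps where
  "mps_one e = (if e = 0 then 1 else 0)"

definition mps_monom :: "mono \<Rightarrow> mps" where
  "mps_monom a e = (if e = a then 1 else 0)"

definition mps_add :: "mps \<Rightarrow> mps \<Rightarrow> mps" where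
  "mps_add f g e = f e + g e"

definition mps_sub :: "mps \<Rightarrow> mps \<Rightarrow> mps" where
  "mps_sub f g e = f e - g e"

definition mps_mult :: "mps \<Rightarrow> mps \<Rightarrow> mps" where
  "mps_mult f g e = (\<Sum>(a, b) \<in> {(a, b). a + b = e}. f a * g b)"

primrec mps_pow :: "mps \<Rightarrow> nat \<Rightarrow> mps" where
  "mps_pow f 0 = mps_one"
| "mps_pow f (Suc k) = mps_mult f (mps_pow f k)"

definition total_deg :: "mono \<Rightarrow> nat" where
  "total_deg e = (\<Sum>i\<in>Poly_Mapping.keys e. Poly_Mapping.lookup e i)"

text \<open>For a series f with zero constant term, \<open>mps_geom f = 1/(1 - f) = \<Sum>k. f^k\<close>
  (only powers k \<le> total degree contribute to a given coefficient).\<close>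
definition mps_geom :: "mps \<Rightarrow> mps" where
  "mps_geom f e = (\<Sum>k\<le>total_deg e. mps_pow f k e)"

text \<open>\<open>mps_div a g = a / g\<close> for a series g with constant term 1.\<close>
definition mps_div :: "mps \<Rightarrow> mps \<Rightarrow> mps" where
  "mps_div a g = mps_mult a (mps_geom (mps_sub mps_one g))"

definition mexp :: "nat \<Rightarrow> mono" where
  "mexp n = (\<Sum>i\<le>n. Poly_Mapping.single (i + 1) (n choose i))"

definition mser :: "nat \<Rightarrow> mps" where
  "mser n = mps_monom (mexp n)"

fun cf_tail :: "nat \<Rightarrow> nat \<Rightarrow> mps" where
  "cf_tail 0 n = (\<lambda>_. 0)"
| "cf_tail (Suc d) n =
     mps_div (mser n) (mps_sub (mps_sub mps_one (mser n)) (cf_tail d (Suc n)))"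

definition cf_approx :: "nat \<Rightarrow> mps" where
  "cf_approx d = mps_add mps_one (cf_tail d 0)"

definition lhs_series :: mps where
  "lhs_series e = int (card {\<pi>. is_perm \<pi> \<and> avoids_all \<pi> {[1,2,4,3], [2,1,4,3]} \<and>
       Poly_Mapping.lookup e 0 = 0 \<and> (\<forall>k\<ge>1. tau k \<pi> = Poly_Mapping.lookup e k)})"

end

theory Submission
  imports Defs "HOL-Library.Sublist"
begin

text \<open>Let \<open>F n\<close> be the generating function of the nonempty avoiders after \<open>n\<close> substitutions
  \<open>x_k \<mapsto> x_k x_{k+1}\<close>; appending a new maximum to a permutation performs one such
  substitution, up to the factor \<open>x_1\<close> of the new entry alone. Split an avoider at its maximum \<open>N\<close>
  as \<open>L N Q\<close>. If \<open>L\<close> is nonempty with minimum \<open>a\<close>, avoidance forces every entry of \<open>L\<close> other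
  than \<open>a\<close> to exceed all of \<open>Q\<close>, so an increasing subsequence lies in \<open>L N\<close> or in \<open>a Q\<close>, and
  \<open>L\<close> and \<open>a Q\<close> are arbitrary nonempty avoiders. Together with the case of empty \<open>L\<close> this gives
  \<open>F n = m_n + m_n F n + F (n + 1) F n\<close>, the recursion of the continued fraction.\<close>

section \<open>Power series and the continued fraction\<close>

lemma total_deg_superset:
  assumes "finite S" "Poly_Mapping.keys e \<subseteq> S"
  shows "total_deg e = (\<Sum>i\<in>S. Poly_Mapping.lookup e i)"
  unfolding total_deg_def using assms
  by (intro sum.mono_neutral_left) (auto simp: in_keys_iff)

lemma total_deg_add: "total_deg (a + b) = total_deg a + total_deg b"
proof -
  let ?S = "Poly_Mapping.keys a \<union> Poly_Mapping.keys b"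
  have "total_deg (a + b) = (\<Sum>i\<in>?S. Poly_Mapping.lookup (a + b) i)"
    by (rule total_deg_superset) (auto simp: Poly_Mapping.keys_add)
  also have "\<dots> = total_deg a + total_deg b"
    by (simp add: lookup_add sum.distrib total_deg_superset[of ?S])
  finally show ?thesis .
qed

lemma total_deg_eq_0_iff: "total_deg e = 0 \<longleftrightarrow> e = 0"
  by (auto simp: total_deg_def in_keys_iff intro!: poly_mapping_eqI)

text \<open>A splitting is determined by its first summand, a function supported on the keys of
  \<open>e\<close> with values at most \<open>total_deg e\<close>. Over an infinite index set the
  sum in \<open>mps_mult\<close> would collapse to 0.\<close>

lemma finite_splittings: "finite {(a, b). a + b = (e :: mono)}"
proof -
  let ?K = "Poly_Mapping.keys e"
  have "inj_on (\<lambda>p. Poly_Mapping.lookup (fst p)) {(a, b). a + b = e}"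
    by (auto simp: inj_on_def lookup_inject)
  moreover have "(\<lambda>p. Poly_Mapping.lookup (fst p)) ` {(a, b). a + b = e} \<subseteq>
      {f. \<forall>i. (i \<in> ?K \<longrightarrow> f i \<in> {..total_deg e}) \<and> (i \<notin> ?K \<longrightarrow> f i = 0)}"
  proof (safe, goal_cases)
    case (1 _ a b i)
    have "Poly_Mapping.lookup (a + b) i \<le> total_deg (a + b)"
      unfolding total_deg_def using 1 by (intro member_le_sum) auto
    then show ?case by (simp add: lookup_add)
  next
    case (2 _ a b i)
    then show ?case by (simp add: in_keys_iff lookup_add)
  qed
  ultimately show ?thesis
    using finite_set_of_finite_funs[of ?K "{..total_deg e}" 0]
    by (meson finite_atMost finite_imageD finite_keys finite_subset)
qed

lemma mps_mult_commute: "mps_mult f g = mps_mult g f"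
proof
  fix e
  show "mps_mult f g e = mps_mult g f e"
    unfolding mps_mult_def
    by (rule sum.reindex_bij_witness[of _ prod.swap prod.swap]) (auto simp: add.commute)
qed

text \<open>Flattening the nested convolution to a sum over triples makes the three factors
  symmetric, so that rearranging factors becomes permuting triples.\<close>

lemma mps_mult_triple:
  "mps_mult f (mps_mult g h) e = (\<Sum>(a, b, c)\<in>{(a, b, c). a + (b + c) = e}. f a * (g b * h c))"
proof -
  let ?S = "Sigma {(a, b). a + b = e} (\<lambda>(a, b). {(c, d). c + d = b})"
  have "mps_mult f (mps_mult g h) e =
    (\<Sum>p\<in>{(a, b). a + b = e}. \<Sum>q\<in>(case p of (a, b) \<Rightarrow> {(c, d). c + d = b}).
       f (fst p) * (g (fst q) * h (snd q)))"
    unfolding mps_mult_def sum_distrib_left by (simp add: case_prod_beta)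
  also have "\<dots> = (\<Sum>(p, q)\<in>?S. f (fst p) * (g (fst q) * h (snd q)))"
    by (rule sum.Sigma) (auto simp: finite_splittings)
  also have "\<dots> = (\<Sum>(a, b, c)\<in>{(a, b, c). a + (b + c) = e}. f a * (g b * h c))"
    by (rule sum.reindex_bij_witness[of _ "\<lambda>(a, b, c). ((a, b + c), (b, c))" "\<lambda>((a, _), (c, d)). (a, c, d)"])
      auto
  finally show ?thesis .
qed

lemma mps_mult_left_commute: "mps_mult f (mps_mult g h) = mps_mult g (mps_mult f h)"
  unfolding fun_eq_iff mps_mult_triple
  by (intro allI, rule sum.reindex_bij_witness[of _ "\<lambda>(a, b, c). (b, a, c)" "\<lambda>(a, b, c). (b, a, c)"])
    (auto simp: add.left_commute)

lemma mps_mult_add_left: "mps_mult (mps_add f g) h = mps_add (mps_mult f h) (mps_mult g h)"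
  unfolding fun_eq_iff mps_mult_def mps_add_def
  by (auto simp: sum.distrib[symmetric] algebra_simps intro!: sum.cong)

lemma mps_mult_add_right: "mps_mult f (mps_add g h) = mps_add (mps_mult f g) (mps_mult f h)"
  by (simp add: mps_mult_commute[of f] mps_mult_add_left)

lemma mps_mult_one: "mps_mult f mps_one = f"
proof
  fix e
  have "mps_mult f mps_one e = (\<Sum>p\<in>{(e, 0)}. case p of (a, b) \<Rightarrow> f a * mps_one b)"
    unfolding mps_mult_def
    by (rule sum.mono_neutral_right) (auto simp: finite_splittings mps_one_def split: if_splits)
  then show "mps_mult f mps_one e = f e" by (simp add: mps_one_def)
qed

lemma mps_mult_zero_coeff:
  assumes "\<And>a b. a + b = e \<Longrightarrow> f a = 0 \<or> g b = 0"
  shows "mps_mult f g e = 0"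
  unfolding mps_mult_def by (rule sum.neutral) (use assms in fastforce)

text \<open>Each factor \<open>f\<close> contributes degree at least 1, its constant term being 0.
  Hence the truncated sum in \<open>mps_geom\<close> omits only zero terms.\<close>

lemma mps_pow_eq_0:
  assumes "f 0 = 0" "total_deg e < k"
  shows "mps_pow f k e = 0"
  using assms(2)
proof (induction k arbitrary: e)
  case (Suc k)
  show ?case unfolding mps_pow.simps
  proof (rule mps_mult_zero_coeff)
    fix a b assume "a + b = e"
    then have "total_deg a = 0 \<or> total_deg b < k"
      using Suc.prems by (auto simp: total_deg_add)
    then show "f a = 0 \<or> mps_pow f k b = 0"
      using Suc.IH assms(1) by (auto simp: total_deg_eq_0_iff)
  qed
qed simp

lemma mps_geom_unfold:
  assumes "f 0 = 0"
  shows "mps_geom f = mps_add mps_one (mps_mult f (mps_geom f))"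
proof
  fix e
  let ?N = "total_deg e"
  \<comment> \<open>The truncation of \<open>mps_geom f b\<close> depends on \<open>b\<close>.
    Raising it to the common bound \<open>?N\<close> adds only vanishing powers and lets the two
    sums be exchanged.\<close>
  have geom: "mps_geom f b = (\<Sum>k\<le>?N. mps_pow f k b)" if "a + b = e" for a b
    unfolding mps_geom_def using that mps_pow_eq_0[of f, OF assms]
    by (intro sum.mono_neutral_left) (auto simp: total_deg_add)
  have "mps_mult f (mps_geom f) e = (\<Sum>(a, b)\<in>{(a, b). a + b = e}. \<Sum>k\<le>?N. f a * mps_pow f k b)"
    unfolding mps_mult_def using geom by (intro sum.cong) (auto simp: sum_distrib_left)
  also have "\<dots> = (\<Sum>k\<le>?N. mps_pow f (Suc k) e)"
    by (simp add: case_prod_beta mps_mult_def sum.swap[of _ "{..?N}"])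
  also have "mps_one e + \<dots> = (\<Sum>k\<le>Suc ?N. mps_pow f k e)"
    by (simp only: sum.atMost_Suc_shift mps_pow.simps)
  also have "\<dots> = mps_geom f e"
    using mps_pow_eq_0[of f e "Suc ?N", OF assms] by (simp add: mps_geom_def del: mps_pow.simps)
  finally show "mps_geom f e = mps_add mps_one (mps_mult f (mps_geom f)) e"
    by (simp add: mps_add_def)
qed

text \<open>The quotient is presented as a solution of y = a + (1 - g) y, the shape in which the
  recursion for avoiders arises.\<close>

lemma mps_div_unfold:
  assumes "g 0 = 1"
  shows "mps_div a g = mps_add a (mps_mult (mps_sub mps_one g) (mps_div a g))"
proof -
  have "mps_sub mps_one g 0 = 0"
    using assms by (simp add: mps_sub_def mps_one_def)
  from mps_geom_unfold[of "mps_sub mps_one g", OF this] have "mps_div a g = mps_mult a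
      (mps_add mps_one (mps_mult (mps_sub mps_one g) (mps_geom (mps_sub mps_one g))))"
    unfolding mps_div_def by simp
  then show ?thesis
    by (simp add: mps_mult_add_right mps_mult_one mps_div_def mps_mult_left_commute[of a])
qed

section \<open>Divisibility by x_1 and the recursion of the truncated fractions\<close>

lemma lookup_mexp_1: "Poly_Mapping.lookup (mexp n) 1 = 1"
proof -
  have "Poly_Mapping.lookup (mexp n) 1 = (\<Sum>i\<le>n. if i = 0 then 1 else 0)"
    unfolding mexp_def lookup_sum by (intro sum.cong) (auto simp: lookup_single)
  then show ?thesis by simp
qed

lemma mser_eq_0: "Poly_Mapping.lookup e 1 = 0 \<Longrightarrow> mser n e = 0"
  using lookup_mexp_1[of n] by (auto simp: mser_def mps_monom_def)

lemma cf_tail_eq_0: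
  assumes "Poly_Mapping.lookup e 1 = 0"
  shows "cf_tail d n e = 0"
proof (cases d)
  case (Suc d')
  show ?thesis unfolding Suc cf_tail.simps mps_div_def
    by (rule mps_mult_zero_coeff, rule disjI1, rule mser_eq_0) (use assms in \<open>auto simp: lookup_add\<close>)
qed simp

text \<open>For the denominator g of the fraction, 1 - g is m_n plus the next tail. This is the
  recursion of \<open>F n\<close>, except that the depth drops in the next tail.\<close>

lemma cf_tail_unfold:
  "cf_tail (Suc d) n =
    mps_add (mser n) (mps_mult (mps_add (mser n) (cf_tail d (Suc n))) (cf_tail (Suc d) n))"
proof -
  let ?g = "mps_sub (mps_sub mps_one (mser n)) (cf_tail d (Suc n))"
  have "?g 0 = 1"
    by (simp add: mps_sub_def mser_eq_0 cf_tail_eq_0 mps_one_def)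
  moreover have "mps_sub mps_one ?g = mps_add (mser n) (cf_tail d (Suc n))"
    by (auto simp: mps_sub_def mps_add_def)
  ultimately show ?thesis
    using mps_div_unfold[of ?g "mser n"] by simp
qed

text \<open>Every \<open>F n\<close> and every \<open>cf_tail d n\<close> is divisible by \<open>x_1\<close>, so the recursion determines
  a coefficient from coefficients of smaller \<open>x_1\<close>-degree.\<close>

lemma cf_tail_eq_solution:
  fixes F :: "nat \<Rightarrow> mps"
  assumes F_rec: "\<And>n. F n = mps_add (mser n) (mps_mult (mps_add (mser n) (F (Suc n))) (F n))"
    and F_0: "\<And>n e. Poly_Mapping.lookup e 1 = 0 \<Longrightarrow> F n e = 0"
  shows "Poly_Mapping.lookup e 1 \<le> d \<Longrightarrow> cf_tail d n e = F n e"
proof (induction d arbitrary: n e)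
  case 0
  then show ?case by (simp add: F_0)
next
  case (Suc d)
  note outer = Suc.IH
  show ?case using Suc.prems
  proof (induction "Poly_Mapping.lookup e 1" arbitrary: e rule: less_induct)
    case less
    let ?T = "cf_tail (Suc d) n" and ?h = "mps_add (mser n) (cf_tail d (Suc n))"
      and ?k = "mps_add (mser n) (F (Suc n))"
    have "?h a * ?T b = ?k a * F n b" if "a + b = e" for a b
    \<comment> \<open>If \<open>a\<close> or \<open>b\<close> lacks x_1, both products vanish.
      Otherwise both have smaller x_1-degree than \<open>e\<close>: the outer induction on the depth
      covers \<open>a\<close>, the inner one on the degree covers \<open>b\<close>.\<close>
    proof (cases "Poly_Mapping.lookup a 1 = 0 \<or> Poly_Mapping.lookup b 1 = 0")
      case True
      then show ?thesis
        by (auto simp: mps_add_def mser_eq_0 cf_tail_eq_0 F_0 simp del: cf_tail.simps)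
    next
      case False
      then have "Poly_Mapping.lookup b 1 < Poly_Mapping.lookup e 1" "Poly_Mapping.lookup a 1 \<le> d"
        using that less.prems by (auto simp: lookup_add)
      then show ?thesis
        using less.hyps[of b] less.prems outer[of a "Suc n"] by (simp add: mps_add_def)
    qed
    then have "mps_mult ?h ?T e = mps_mult ?k (F n) e"
      unfolding mps_mult_def by (intro sum.cong) auto
    then show ?case
      by (subst cf_tail_unfold, subst F_rec) (simp add: mps_add_def)
  qed
qed

section \<open>Increasing subsequences and the patterns\<close>

text \<open>The exponent vector of \<open>x_k\<close> after \<open>n\<close> substitutions \<open>x_j \<mapsto> x_j x_{j+1}\<close>.\<close>

definition shift_exp :: "nat \<Rightarrow> nat \<Rightarrow> mono" where
  "shift_exp n k = (\<Sum>i\<le>n. Poly_Mapping.single (k + i) (n choose i))"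

text \<open>Subsequences are recorded by values instead of positions, which is faithful for distinct
  entries. The empty one is left out because there is no variable x_0.\<close>

definition incs :: "nat list \<Rightarrow> nat list set" where
  "incs \<pi> = {s. subseq s \<pi> \<and> s \<noteq> [] \<and> sorted_wrt (<) s}"

definition wt :: "nat \<Rightarrow> nat list \<Rightarrow> mono" where
  "wt n \<pi> = (\<Sum>s\<in>incs \<pi>. shift_exp n (length s))"

text \<open>Both patterns at once: 1243 and 2143 differ only in the order of their first two
  entries, so \<open>x\<close> and \<open>y\<close> are not compared.\<close>

definition bad :: "nat list \<Rightarrow> bool" where
  "bad \<pi> \<longleftrightarrow> (\<exists>x y u v. subseq [x, y, u, v] \<pi> \<and> x < v \<and> y < v \<and> v < u)"

definition avoiders :: "nat list set" where
  "avoiders = {\<pi>. is_perm \<pi> \<and> \<not> bad \<pi> \<and> \<pi> \<noteq> []}"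

text \<open>This is the \<open>F n\<close> of the overview.\<close>

definition avoider_series :: "nat \<Rightarrow> mps" where
  "avoider_series n e = int (card {\<pi> \<in> avoiders. wt n \<pi> = e})"

text \<open>Pascal's rule. It expresses one substitution x_k -> x_k x_{k+1}: an increasing
  subsequence is counted as it stands and once more with a larger entry appended.\<close>

lemma shift_exp_Suc: "shift_exp (Suc n) k = shift_exp n k + shift_exp n (Suc k)"
proof -
  have "shift_exp (Suc n) k = Poly_Mapping.single k 1 +
      (\<Sum>i\<le>n. Poly_Mapping.single (k + Suc i) ((n choose i) + (n choose Suc i)))"
    unfolding shift_exp_def by (simp only: sum.atMost_Suc_shift) simp
  also have "\<dots> = (Poly_Mapping.single k 1 +
      (\<Sum>i\<le>n. Poly_Mapping.single (k + Suc i) (n choose Suc i))) + shift_exp n (Suc k)"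
    by (simp add: shift_exp_def single_add sum.distrib add_ac)
  also have "Poly_Mapping.single k 1 + (\<Sum>i\<le>n. Poly_Mapping.single (k + Suc i) (n choose Suc i)) =
      (\<Sum>i\<le>Suc n. Poly_Mapping.single (k + i) (n choose i))"
    by (simp only: sum.atMost_Suc_shift) simp
  also have "\<dots> = shift_exp n k"
    by (simp add: shift_exp_def binomial_eq_0)
  finally show ?thesis .
qed

lemma lookup_shift_exp_1:
  assumes "k \<ge> 1"
  shows "Poly_Mapping.lookup (shift_exp n k) 1 = (if k = 1 then 1 else 0)"
proof -
  have "Poly_Mapping.lookup (shift_exp n k) 1 = (\<Sum>i\<le>n. if i = 0 then if k = 1 then 1 else 0 else 0)"
    unfolding shift_exp_def lookup_sum
    by (intro sum.cong) (use assms in \<open>auto simp: lookup_single when_def\<close>)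
  then show ?thesis by simp
qed

lemma finite_subseq: "finite {s. subseq s xs \<and> P s}"
  by (rule finite_subset[of _ "set (subseqs xs)"]) auto

lemma finite_incs: "finite (incs \<pi>)"
  unfolding incs_def by (rule finite_subseq)

lemma incs_Nil: "incs [] = {}"
  by (auto simp: incs_def)

text \<open>Only subsequences of length 1 contribute x_1, whatever \<open>n\<close> is. So the
  x_1-degree records the length of the permutation.\<close>

lemma lookup_wt_1: "distinct \<pi> \<Longrightarrow> Poly_Mapping.lookup (wt n \<pi>) 1 = length \<pi>"
proof -
  assume "distinct \<pi>"
  have "Poly_Mapping.lookup (wt n \<pi>) 1 = (\<Sum>s\<in>incs \<pi>. if length s = 1 then 1 else 0)"
    unfolding wt_def lookup_sum
    by (intro sum.cong refl lookup_shift_exp_1) (auto simp: incs_def Suc_le_eq)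
  also have "\<dots> = card {s \<in> incs \<pi>. length s = 1}"
    by (simp add: finite_incs flip: sum.inter_filter)
  also have "{s \<in> incs \<pi>. length s = 1} = (\<lambda>x. [x]) ` set \<pi>"
    by (auto simp: incs_def length_Suc_conv subseq_singleton_left)
  also have "card \<dots> = length \<pi>"
    using \<open>distinct \<pi>\<close> by (simp add: card_image inj_on_def distinct_card)
  finally show ?thesis .
qed

section \<open>Agreement with the definitions by index sets and patterns\<close>

lemma nths_restrict: "nths xs (I \<inter> {..<length xs}) = nths xs I"
  unfolding nths_def by (intro arg_cong[of _ _ "map fst"] filter_cong) (auto dest: set_zip_rightD)

lemma subseq_conv_nths_bounded: "subseq s xs \<longleftrightarrow> (\<exists>I\<subseteq>{..<length xs}. s = nths xs I)"
  by (metis Int_lower2 nths_restrict subseq_conv_nths)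

text \<open>In a distinct list an index set can be recovered from the set of entries it selects, so
  counting index sets and counting subsequences agree.\<close>

lemma tau_conv_subseq:
  assumes "distinct \<pi>"
  shows "tau k \<pi> = card {s. subseq s \<pi> \<and> length s = k \<and> sorted_wrt (<) s}"
  unfolding tau_def
proof (rule bij_betw_same_card[of "nths \<pi>"], rule bij_betw_imageI)
  have len: "length (nths \<pi> I) = card I" if "I \<subseteq> {..<length \<pi>}" for I
  proof -
    have "{i. i < length \<pi> \<and> i \<in> I} = I" using that by auto
    then show ?thesis by (simp add: length_nths)
  qed
  show "inj_on (nths \<pi>) {I. I \<subseteq> {..<length \<pi>} \<and> card I = k \<and> sorted_wrt (<) (nths \<pi> I)}"
  proof (rule inj_onI, clarify)
    fix I J assume *: "I \<subseteq> {..<length \<pi>}" "J \<subseteq> {..<length \<pi>}" "nths \<pi> I = nths \<pi> J"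
    have "(!) \<pi> ` I = set (nths \<pi> I)" if "I \<subseteq> {..<length \<pi>}" for I
      using that by (auto simp: set_nths)
    then have "(!) \<pi> ` I = (!) \<pi> ` J"
      using * by metis
    then show "I = J"
      using inj_on_image_eq_iff[OF inj_on_nth[OF assms, of "{..<length \<pi>}"]] *(1,2) by auto
  qed
  show "nths \<pi> ` {I. I \<subseteq> {..<length \<pi>} \<and> card I = k \<and> sorted_wrt (<) (nths \<pi> I)} =
      {s. subseq s \<pi> \<and> length s = k \<and> sorted_wrt (<) s}"
    using len unfolding subseq_conv_nths_bounded by auto
qed

lemma contains_conv_subseq: "contains \<pi> \<sigma> \<longleftrightarrow> (\<exists>s. subseq s \<pi> \<and> order_iso s \<sigma>)"
  unfolding contains_def subseq_conv_nths_bounded by blast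

lemma all_less_4: "(\<forall>i<4. P i) \<longleftrightarrow> P 0 \<and> P 1 \<and> P 2 \<and> P (3::nat)"
  by (auto simp: numeral_eq_Suc less_Suc_eq)

lemma length_eq_4: "length s = 4 \<longleftrightarrow> (\<exists>x y u v. s = [x, y, u, v])"
  by (auto simp: numeral_eq_Suc length_Suc_conv)

text \<open>Comparisons of a position with itself are trivial; the twelve others are spelled
  out.\<close>

lemma order_iso_4:
  "order_iso s [a, b, c, d] \<longleftrightarrow> (\<exists>x y u v. s = [x, y, u, v] \<and>
     (x < y \<longleftrightarrow> a < b) \<and> (x < u \<longleftrightarrow> a < c) \<and> (x < v \<longleftrightarrow> a < d) \<and>
     (y < x \<longleftrightarrow> b < a) \<and> (y < u \<longleftrightarrow> b < c) \<and> (y < v \<longleftrightarrow> b < d) \<and>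
     (u < x \<longleftrightarrow> c < a) \<and> (u < y \<longleftrightarrow> c < b) \<and> (u < v \<longleftrightarrow> c < d) \<and>
     (v < x \<longleftrightarrow> d < a) \<and> (v < y \<longleftrightarrow> d < b) \<and> (v < u \<longleftrightarrow> d < c))"
proof -
  have "order_iso s [a, b, c, d] \<longleftrightarrow>
      length s = 4 \<and> (\<forall>i<4. \<forall>j<4. (s ! i < s ! j) \<longleftrightarrow> ([a, b, c, d] ! i < [a, b, c, d] ! j))"
    by (auto simp: order_iso_def)
  then show ?thesis
    unfolding all_less_4 length_eq_4 by (elim ssubst) (intro iffI; elim exE conjE; simp; fail)
qed

lemma order_iso_1243:
  "order_iso s [1,2,4,3] \<longleftrightarrow> (\<exists>x y u v. s = [x,y,u,v] \<and> x < y \<and> y < v \<and> v < u)"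
  unfolding order_iso_4 by (intro arg_cong[where f = Ex] ext) auto

lemma order_iso_2143:
  "order_iso s [2,1,4,3] \<longleftrightarrow> (\<exists>x y u v. s = [x,y,u,v] \<and> y < x \<and> x < v \<and> v < u)"
  unfolding order_iso_4 by (intro arg_cong[where f = Ex] ext) auto

lemma distinct_subseq: "subseq xs ys \<Longrightarrow> distinct ys \<Longrightarrow> distinct xs"
  by (auto simp: subseq_conv_nths distinct_nthsI)

text \<open>Distinctness rules out \<open>x = y\<close>; then \<open>x < y\<close> gives 1243 and
  \<open>y < x\<close> gives 2143.\<close>

lemma avoids_all_iff_not_bad:
  assumes "distinct \<pi>"
  shows "avoids_all \<pi> {[1,2,4,3], [2,1,4,3]} \<longleftrightarrow> \<not> bad \<pi>"
proof -
  have "x \<noteq> y" if "subseq [x,y,u,v] \<pi>" for x y u v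
    using distinct_subseq[OF that assms] by auto
  then show ?thesis
    unfolding avoids_all_def ball_simps contains_conv_subseq order_iso_1243 order_iso_2143 bad_def
    by (blast intro: order_less_trans elim: linorder_neqE_nat)
qed

lemma lookup_wt_0:
  assumes "distinct \<pi>"
  shows "Poly_Mapping.lookup (wt 0 \<pi>) k = (if k = 0 then 0 else tau k \<pi>)"
proof -
  have "Poly_Mapping.lookup (wt 0 \<pi>) k = (\<Sum>s\<in>incs \<pi>. if length s = k then 1 else 0)"
    by (simp add: wt_def shift_exp_def lookup_sum lookup_single when_def cong: if_cong)
  also have "\<dots> = card {s \<in> incs \<pi>. length s = k}"
    by (simp add: finite_incs flip: sum.inter_filter)
  also have "{s \<in> incs \<pi>. length s = k} =
      (if k = 0 then {} else {s. subseq s \<pi> \<and> length s = k \<and> sorted_wrt (<) s})"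
    by (auto simp: incs_def)
  finally show ?thesis using tau_conv_subseq[OF assms] by auto
qed

text \<open>The weight fixes the length through its x_1-degree. Finiteness keeps the
  \<open>card\<close> in \<open>avoider_series\<close> from degenerating to 0.\<close>

lemma finite_avoiders_wt: "finite {\<pi> \<in> avoiders. wt n \<pi> = e}"
proof (rule finite_subset)
  let ?l = "Poly_Mapping.lookup e 1"
  show "{\<pi> \<in> avoiders. wt n \<pi> = e} \<subseteq> {\<pi>. set \<pi> \<subseteq> {1..?l} \<and> length \<pi> = ?l}"
    using lookup_wt_1 by (auto simp: avoiders_def is_perm_def)
  show "finite {\<pi>. set \<pi> \<subseteq> {1..?l} \<and> length \<pi> = ?l}"
    by (rule finite_lists_length_eq) simp
qed

lemma avoider_series_eq_0: "Poly_Mapping.lookup e 1 = 0 \<Longrightarrow> avoider_series n e = 0"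
  using lookup_wt_1 by (force simp: avoider_series_def avoiders_def is_perm_def card_eq_0_iff)

text \<open>The summand 1 is the empty permutation, which \<open>avoiders\<close> excludes. The
  condition on index 0 matches \<open>wt 0\<close>, whose entry there is always 0.\<close>

lemma lhs_series_eq: "lhs_series = mps_add mps_one (avoider_series 0)"
proof
  fix e
  let ?B = "{\<pi>. is_perm \<pi> \<and> avoids_all \<pi> {[1,2,4,3], [2,1,4,3]} \<and>
       Poly_Mapping.lookup e 0 = 0 \<and> (\<forall>k\<ge>1. tau k \<pi> = Poly_Mapping.lookup e k)}"
  have "(Poly_Mapping.lookup e 0 = 0 \<and> (\<forall>k\<ge>1. tau k \<pi> = Poly_Mapping.lookup e k)) \<longleftrightarrow> wt 0 \<pi> = e"
    if "is_perm \<pi>" for \<pi>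
    using that unfolding is_perm_def poly_mapping_eq_iff fun_eq_iff
    by (auto simp: lookup_wt_0 Suc_le_eq split: if_splits)
  then have "?B = {\<pi>. is_perm \<pi> \<and> \<not> bad \<pi> \<and> wt 0 \<pi> = e}"
    using avoids_all_iff_not_bad by (auto simp: is_perm_def)
  also have "\<dots> = {\<pi> \<in> avoiders. wt 0 \<pi> = e} \<union> (if e = 0 then {[]} else {})"
    by (auto simp: avoiders_def is_perm_def bad_def wt_def incs_Nil)
  also have "card \<dots> = card {\<pi> \<in> avoiders. wt 0 \<pi> = e} + card (if e = 0 then {[]::nat list} else {})"
    by (rule card_Un_disjoint, rule finite_avoiders_wt) (auto simp: avoiders_def)
  finally show "lhs_series e = mps_add mps_one (avoider_series 0) e"
    by (auto simp: lhs_series_def mps_add_def mps_one_def avoider_series_def)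
qed

section \<open>Splitting at the maximum\<close>

lemma subseq_map_conv: "subseq s (map f xs) \<longleftrightarrow> (\<exists>t. s = map f t \<and> subseq t xs)"
  by (metis nths_map subseq_conv_nths)

lemma subseq_set_mono: "subseq xs ys \<Longrightarrow> set xs \<subseteq> set ys"
  by (auto simp: subseq_conv_nths dest: in_set_nthsD)

lemma incs_map:
  assumes "strict_mono_on (set xs) f"
  shows "incs (map f xs) = map f ` incs xs"
proof -
  have "sorted_wrt (<) (map f t) \<longleftrightarrow> sorted_wrt (<) t" if "subseq t xs" for t
    using subseq_set_mono[OF that] strict_mono_on_less[OF assms]
    by (auto simp: sorted_wrt_map sorted_wrt_iff_nth_less subset_iff)
  then show ?thesis
    unfolding incs_def subseq_map_conv by auto
qed

text \<open>Weights depend only on relative order. This allows the left piece of a split permutation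
  to be renumbered to a permutation.\<close>

lemma wt_map:
  assumes "strict_mono_on (set xs) f"
  shows "wt n (map f xs) = wt n xs"
proof -
  have "inj_on (map f) (incs xs)"
    by (rule inj_on_subset[OF inj_on_map_lists[OF strict_mono_on_imp_inj_on[OF assms]]])
      (auto simp: incs_def dest!: subseq_set_mono)
  then show ?thesis
    by (simp add: wt_def incs_map[OF assms] sum.reindex)
qed

lemma bad_map:
  assumes "strict_mono_on (set xs) f"
  shows "bad (map f xs) \<longleftrightarrow> bad xs"
proof
  assume "bad (map f xs)"
  then obtain x y u v where *: "subseq [x, y, u, v] (map f xs)" "x < v" "y < v" "v < u"
    unfolding bad_def by blast
  then obtain x' y' u' v' where s: "subseq [x', y', u', v'] xs"
    and eq: "x = f x'" "y = f y'" "u = f u'" "v = f v'"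
    by (auto simp: subseq_map_conv Cons_eq_map_conv)
  show "bad xs"
    using * s subseq_set_mono[OF s] strict_mono_on_less[OF assms] unfolding bad_def eq
    by (intro exI[of _ x'] exI[of _ y'] exI[of _ u'] exI[of _ v']) auto
next
  assume "bad xs"
  then obtain x y u v where *: "subseq [x, y, u, v] xs" "x < v" "y < v" "v < u"
    unfolding bad_def by blast
  then have "subseq [f x, f y, f u, f v] (map f xs)"
    using subseq_map[OF *(1), of f] by simp
  moreover have "f x < f v" "f y < f v" "f v < f u"
    using * subseq_set_mono[OF *(1)] strict_mono_on_less[OF assms] by auto
  ultimately show "bad (map f xs)"
    unfolding bad_def by blast
qed

lemma bad_mono: "bad xs \<Longrightarrow> subseq xs ys \<Longrightarrow> bad ys"
  unfolding bad_def by (meson subseq_order.trans)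

lemma subseq_ConsD: "subseq s (x # xs) \<Longrightarrow> (\<exists>t. s = x # t \<and> subseq t xs) \<or> subseq s xs"
  by (cases s) (simp_all split: if_splits)

text \<open>Nothing larger follows a leading maximum, so it is increasing only on its own and cannot
  serve as \<open>x\<close> in a bad quadruple, where \<open>x < v\<close>.\<close>

lemma Cons_max:
  assumes "\<And>x. x \<in> set xs \<Longrightarrow> x < N"
  shows wt_Cons_max: "wt n (N # xs) = shift_exp n 1 + wt n xs"
    and bad_Cons_max: "bad (N # xs) \<longleftrightarrow> bad xs"
proof -
  have "incs (N # xs) = insert [N] (incs xs)"
  proof (intro set_eqI iffI)
    fix s assume s: "s \<in> incs (N # xs)"
    then have "(\<exists>t. s = N # t \<and> subseq t xs) \<or> subseq s xs"
      by (intro subseq_ConsD) (simp add: incs_def)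
    moreover have "t = []" if "s = N # t" "subseq t xs" for t
      using that s assms subseq_set_mono[OF that(2)]
      by (cases t) (auto simp: incs_def dest: less_asym)
    ultimately show "s \<in> insert [N] (incs xs)"
      using s by (auto simp: incs_def)
  qed (auto simp: incs_def)
  moreover have "[N] \<notin> incs xs"
    using assms by (auto simp: incs_def subseq_singleton_left)
  ultimately show "wt n (N # xs) = shift_exp n 1 + wt n xs"
    by (simp add: wt_def finite_incs)
  have "subseq [x, y, u, v] xs" if "subseq [x, y, u, v] (N # xs)" "x < v" for x y u v
  proof (cases "x = N")
    case True
    then have "subseq [y, u, v] xs" using that(1) by simp
    then show ?thesis using subseq_set_mono[of "[y, u, v]" xs] assms[of v] that(2) True by auto
  next
    case False
    then show ?thesis using that(1) by (rule subseq_Cons2_neq[rotated])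
  qed
  then show "bad (N # xs) \<longleftrightarrow> bad xs"
    unfolding bad_def by (meson list_emb_Cons)
qed

text \<open>The shape that avoidance forces on a word cut at its maximum. Avoidance itself is not
  assumed, so the locale covers glued words as well as avoiders.\<close>

locale max_split =
  fixes L Q :: "nat list" and N a :: nat
  assumes dist: "distinct (L @ N # Q)"
    and a_in: "a \<in> set L"
    and L_less: "x \<in> set L \<Longrightarrow> x < N"
    and Q_less: "y \<in> set Q \<Longrightarrow> y < N"
    and Q_less_L: "x \<in> set L \<Longrightarrow> x \<noteq> a \<Longrightarrow> y \<in> set Q \<Longrightarrow> y < x"
begin

lemma below_Q: "x \<in> set L \<Longrightarrow> y \<in> set Q \<Longrightarrow> x < y \<Longrightarrow> x = a"
  using Q_less_L[of x y] by fastforce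

lemma subseq_a_Q: "subseq (a # Q) (L @ N # Q)"
proof -
  have "subseq [a] L" using a_in by (simp add: subseq_singleton_left)
  moreover have "subseq Q (N # Q)" by (rule list_emb_Cons) simp
  ultimately have "subseq ([a] @ Q) (L @ (N # Q))"
    by (rule list_emb_append_mono)
  then show ?thesis by simp
qed

text \<open>Nothing increasing continues after \<open>N\<close>, and by \<open>below_Q\<close> a
  subsequence that ends in \<open>Q\<close> takes at most \<open>a\<close> from \<open>L\<close>.
  The singleton \<open>[a]\<close> is removed because it already belongs to
  \<open>incs L\<close>.\<close>

lemma incs_split:
  "incs (L @ N # Q) = incs L \<union> (\<lambda>s. s @ [N]) ` incs L \<union> {[N]} \<union> (incs (a # Q) - {[a]})"
    (is "_ = ?R")
proof (intro equalityI subsetI)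
  fix s assume "s \<in> incs (L @ N # Q)"
  then obtain s1 s2 where s: "s = s1 @ s2" "subseq s1 L" "subseq s2 (N # Q)"
    and sorted: "sorted_wrt (<) s" and "s \<noteq> []"
    by (auto simp: incs_def subseq_append_iff)
  have s1_L: "set s1 \<subseteq> set L" using subseq_set_mono[OF s(2)] .
  consider "s2 = []" | t where "s2 = N # t" "subseq t Q" | "s2 \<noteq> []" "subseq s2 Q"
    using subseq_ConsD[OF s(3)] by blast
  then show "s \<in> ?R"
  proof cases
    case 1
    then show ?thesis using s sorted \<open>s \<noteq> []\<close> by (auto simp: incs_def)
  next
    case 2
    then have "t = []"
      using sorted s(1) subseq_set_mono[OF 2(2)] Q_less
      by (cases t) (auto simp: sorted_wrt_append dest: less_asym)
    then show ?thesis
      using 2 s sorted by (cases "s1 = []") (auto simp: incs_def sorted_wrt_append)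
  next
    case 3
    have s2_Q: "set s2 \<subseteq> set Q" using subseq_set_mono[OF 3(2)] .
    have "x = a" if "x \<in> set s1" for x
      using that 3(1) sorted s(1) s1_L s2_Q below_Q[of x "hd s2"]
      by (cases s2) (auto simp: sorted_wrt_append)
    moreover have "distinct s1"
      using distinct_subseq[OF s(2)] dist by simp
    ultimately have "s1 = [] \<or> s1 = [a]"
      by (cases s1 rule: list.exhaust[case_product list.exhaust[of "tl s1"]]) auto
    moreover have "s2 \<noteq> [a]"
      using s2_Q a_in dist by auto
    ultimately show ?thesis
      using s sorted 3 by (auto simp: incs_def)
  qed
next
  fix s assume "s \<in> ?R"
  then consider "s \<in> incs L" | t where "t \<in> incs L" "s = t @ [N]" | "s = [N]" | "s \<in> incs (a # Q)"
    by blast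
  then show "s \<in> incs (L @ N # Q)"
  proof cases
    case 1
    then show ?thesis by (auto simp: incs_def subseq_rev_drop_many)
  next
    case 2
    have "subseq (t @ [N]) (L @ N # Q)"
      using 2 by (intro list_emb_append_mono) (auto simp: incs_def)
    with 2 show ?thesis
      using L_less by (auto simp: incs_def sorted_wrt_append dest!: subseq_set_mono)
  next
    case 3
    then show ?thesis by (auto simp: incs_def subseq_singleton_left)
  next
    case 4
    then show ?thesis using subseq_a_Q subseq_order.trans by (auto simp: incs_def)
  qed
qed

text \<open>The subsequences of \<open>L\<close>, taken with and without a final \<open>N\<close>,
  add up to \<open>wt (Suc n) L\<close> by \<open>shift_exp_Suc\<close>.\<close>

lemma wt_split: "wt n (L @ N # Q) = wt (Suc n) L + wt n (a # Q)"
proof -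
  let ?w = "\<lambda>s::nat list. shift_exp n (length s)"
  have N_notin: "N \<notin> set s" if "s \<in> incs L \<or> s \<in> incs (a # Q)" for s
    using that dist a_in by (auto simp: incs_def dest!: subseq_set_mono)
  have L_aQ: "incs L \<inter> (incs (a # Q) - {[a]}) = {}"
  proof (rule equals0I, elim IntE DiffE)
    fix s assume s: "s \<in> incs L" "s \<in> incs (a # Q)" "s \<notin> {[a]}"
    then have "set s \<subseteq> set L" "set s \<subseteq> insert a (set Q)"
      by (auto simp: incs_def dest!: subseq_set_mono)
    then have "set s \<subseteq> {a}" using dist by auto
    moreover have "distinct s" using s(1) dist distinct_subseq by (auto simp: incs_def)
    ultimately have "s = [] \<or> s = [a]"
      by (cases s rule: list.exhaust[case_product list.exhaust[of "tl s"]]) auto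
    then show False using s by (auto simp: incs_def)
  qed
  \<comment> \<open>As \<open>[N]\<close> and \<open>[a]\<close> have equal length,
    \<open>[N]\<close> fills the gap left by the removed \<open>[a]\<close>.\<close>
  have aQ: "wt n (a # Q) = sum ?w {[N]} + sum ?w (incs (a # Q) - {[a]})"
    unfolding wt_def by (subst sum.remove[OF finite_incs, of "[a]"]) (auto simp: incs_def)
  let ?B = "(\<lambda>s. s @ [N]) ` incs L" and ?D = "incs (a # Q) - {[a]}"
  have B_N: "N \<in> set s" if "s \<in> ?B \<union> {[N]}" for s
    using that by auto
  have "incs L \<inter> ?B = {}" "(incs L \<union> ?B \<union> {[N]}) \<inter> ?D = {}"
    using L_aQ N_notin B_N by blast+
  moreover have "[N] \<notin> incs L \<union> ?B"
    using N_notin[of "[N]"] by (auto simp: incs_def)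
  ultimately have "wt n (L @ N # Q) =
      sum ?w (incs L) + sum ?w ?B + sum ?w {[N]} + sum ?w ?D"
    unfolding wt_def incs_split by (simp add: sum.union_disjoint finite_incs add_ac)
  also have "sum ?w ((\<lambda>s. s @ [N]) ` incs L) = (\<Sum>s\<in>incs L. shift_exp n (Suc (length s)))"
    by (subst sum.reindex) (auto simp: inj_on_def)
  also have "sum ?w (incs L) + \<dots> = wt (Suc n) L"
    by (simp add: wt_def shift_exp_Suc sum.distrib)
  finally show ?thesis by (simp add: aQ add.assoc)
qed

text \<open>If \<open>v\<close> lies after \<open>L\<close>, then \<open>v < u\<close> and
  \<open>u \<le> N\<close> put it in \<open>Q\<close>. Both \<open>x\<close> and \<open>y\<close>
  are below \<open>v\<close>, so at most one of them is in \<open>L\<close>, and that one is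
  \<open>a\<close>.\<close>

lemma bad_split: "bad (L @ N # Q) \<longleftrightarrow> bad L \<or> bad (a # Q)"
proof
  assume "bad (L @ N # Q)"
  then obtain x y u v where s: "subseq [x, y, u, v] (L @ N # Q)" and less: "x < v" "y < v" "v < u"
    unfolding bad_def by blast
  have "x \<noteq> y" using distinct_subseq[OF s dist] by simp
  have tail_le: "z \<le> N" if "subseq t (N # Q)" "z \<in> set t" for z t
    using subseq_set_mono[OF that(1)] that(2) Q_less by (auto simp: less_imp_le)
  have vQ: "v \<in> set Q" if "subseq t (N # Q)" "v \<in> set t" "u \<le> N" for t
    using subseq_set_mono[OF that(1)] that(2,3) less by auto
  have drop: "subseq (z # t) Q" if "subseq (z # t) (N # Q)" "z \<noteq> N" for z t
    using that by (rule subseq_Cons2_neq)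
  obtain s1 s2 where split: "[x, y, u, v] = s1 @ s2" "subseq s1 L" "subseq s2 (N # Q)"
    using s by (auto simp: subseq_append_iff)
  note mem = subseq_set_mono[OF split(2)]
  consider "s2 = []" "s1 = [x,y,u,v]" | "s1 = [x,y,u]" "s2 = [v]" | "s1 = [x,y]" "s2 = [u,v]"
    | "s1 = [x]" "s2 = [y,u,v]" | "s1 = []" "s2 = [x,y,u,v]"
    using split(1) by (auto simp: Cons_eq_append_conv)
  then show "bad L \<or> bad (a # Q)"
  proof cases
    case 1
    then show ?thesis using split less by (auto simp: bad_def)
  next
    case 2
    then have "v \<in> set Q" using vQ[OF split(3)] mem L_less[of u] by auto
    then show ?thesis using below_Q[of x v] below_Q[of y v] mem 2 less \<open>x \<noteq> y\<close> by auto
  next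
    case 3
    then have "v \<in> set Q" using vQ[OF split(3)] tail_le[OF split(3), of u] by auto
    then show ?thesis using below_Q[of x v] below_Q[of y v] mem 3 less \<open>x \<noteq> y\<close> by auto
  next
    case 4
    then have u: "u \<le> N" and v: "v \<in> set Q"
      using vQ[OF split(3)] tail_le[OF split(3), of u] by auto
    have "subseq [y, u, v] Q"
      using drop[of y "[u, v]"] split(3) 4 less u by auto
    moreover have "x = a" using below_Q[of x v] v mem 4 less by auto
    ultimately have "subseq [x, y, u, v] (a # Q)" by simp
    then show ?thesis using less unfolding bad_def by blast
  next
    case 5
    then have "u \<le> N" using tail_le[OF split(3), of u] by auto
    then have "subseq [x, y, u, v] Q"
      using drop[of x "[y, u, v]"] split(3) 5 less by auto
    then show ?thesis using less unfolding bad_def by blast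
  qed
next
  assume "bad L \<or> bad (a # Q)"
  then show "bad (L @ N # Q)"
    using bad_mono subseq_a_Q by (auto simp: subseq_rev_drop_many)
qed

end

section \<open>Gluing two permutations\<close>

lemma is_permI:
  assumes "distinct xs" "set xs \<subseteq> {1..length xs}"
  shows "is_perm xs"
  using assms card_subset_eq[of "{1..length xs}" "set xs"] by (simp add: is_perm_def distinct_card)

lemma is_perm_Cons_max: "is_perm (Suc (length \<pi>) # \<pi>) \<longleftrightarrow> is_perm \<pi>"
proof
  assume "is_perm (Suc (length \<pi>) # \<pi>)"
  then have "distinct \<pi>" "Suc (length \<pi>) \<notin> set \<pi>" "set \<pi> \<subseteq> {1..Suc (length \<pi>)}"
    unfolding is_perm_def by auto
  then show "is_perm \<pi>"
    by (intro is_permI) (auto simp: le_Suc_eq)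
next
  assume "is_perm \<pi>"
  then show "is_perm (Suc (length \<pi>) # \<pi>)"
    by (intro is_permI) (auto simp: is_perm_def)
qed

text \<open>In \<open>glue \<pi> \<rho>\<close> the minimum of \<open>\<pi>\<close> and the first entry of \<open>\<rho>\<close> become the same entry.\<close>

definition glue_map :: "nat list \<Rightarrow> nat \<Rightarrow> nat" where
  "glue_map \<rho> i = (if i = 1 then hd \<rho> else i + length \<rho> - 1)"

definition glue :: "nat list \<Rightarrow> nat list \<Rightarrow> nat list" where
  "glue \<pi> \<rho> = map (glue_map \<rho>) \<pi> @ (length \<pi> + length \<rho>) # tl \<rho>"

context
  fixes \<pi> \<rho> :: "nat list"
  assumes \<pi>: "is_perm \<pi>" "\<pi> \<noteq> []" and \<rho>: "is_perm \<rho>" "\<rho> \<noteq> []"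
begin

lemma hd_in: "hd \<rho> \<in> {1..length \<rho>}"
  using \<rho> hd_in_set unfolding is_perm_def by blast

text \<open>The value 1 goes to \<open>hd \<rho>\<close>, at most \<open>length \<rho>\<close>,
  while the values from 2 on go to consecutive numbers starting at
  \<open>length \<rho> + 1\<close>.\<close>

lemma glue_map_strict_mono: "strict_mono_on (set \<pi>) (glue_map \<rho>)"
  using \<pi> hd_in by (auto simp: strict_mono_on_def is_perm_def glue_map_def)

lemma glue_max_split:
  "max_split (map (glue_map \<rho>) \<pi>) (tl \<rho>) (length \<pi> + length \<rho>) (hd \<rho>)"
proof -
  have set_\<pi>: "set \<pi> = {1..length \<pi>}" and len: "length \<pi> > 0" "length \<rho> > 0"
    using \<pi> \<rho> by (auto simp: is_perm_def)
  have \<rho>_eq: "\<rho> = hd \<rho> # tl \<rho>" using \<rho> by simp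
  have tl: "y \<in> {1..length \<rho>} \<and> y \<noteq> hd \<rho>" if "y \<in> set (tl \<rho>)" for y
    using that \<rho>(1) \<rho>_eq unfolding is_perm_def
    by (metis distinct.simps(2) list.set_intros(2))
  have "distinct (tl \<rho>)" using \<rho> by (simp add: is_perm_def distinct_tl)
  moreover have "distinct (map (glue_map \<rho>) \<pi>)"
    using \<pi> strict_mono_on_imp_inj_on[OF glue_map_strict_mono] by (simp add: distinct_map is_perm_def)
  moreover have L: "x = hd \<rho> \<or> length \<rho> < x \<and> x < length \<pi> + length \<rho>"
    if "x \<in> set (map (glue_map \<rho>) \<pi>)" for x
    using that set_\<pi> len by (auto simp: glue_map_def)
  have hd_less: "hd \<rho> < length \<pi> + length \<rho>"
    using hd_in \<pi>(2) by (cases \<pi>) auto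
  have "length \<pi> + length \<rho> \<notin> set (map (glue_map \<rho>) \<pi>)"
    using hd_less L[of "length \<pi> + length \<rho>"] by (metis less_irrefl)
  moreover have "length \<pi> + length \<rho> \<notin> set (tl \<rho>)"
    using tl[of "length \<pi> + length \<rho>"] \<pi>(2) by auto
  moreover have "x \<notin> set (tl \<rho>)" if "x \<in> set (map (glue_map \<rho>) \<pi>)" for x
    using L[OF that] tl[of x] by auto
  ultimately have dist: "distinct (map (glue_map \<rho>) \<pi> @ (length \<pi> + length \<rho>) # tl \<rho>)"
    unfolding distinct_append distinct.simps list.set by blast
  have hd_mem: "hd \<rho> \<in> set (map (glue_map \<rho>) \<pi>)"
    using image_eqI[of "hd \<rho>" "glue_map \<rho>" 1 "set \<pi>"] set_\<pi> \<pi>(2) by (simp add: glue_map_def Suc_le_eq)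
  show ?thesis
  proof (unfold_locales, rule dist, rule hd_mem)
    fix x y
    show "x < length \<pi> + length \<rho>" if "x \<in> set (map (glue_map \<rho>) \<pi>)"
      using L[OF that] hd_less by blast
    show "y < length \<pi> + length \<rho>" if "y \<in> set (tl \<rho>)"
      using tl[OF that] len unfolding atLeastAtMost_iff by linarith
    show "y < x" if "x \<in> set (map (glue_map \<rho>) \<pi>)" "x \<noteq> hd \<rho>" "y \<in> set (tl \<rho>)"
      using L[OF that(1)] tl[OF that(3)] that(2) by auto
  qed
qed

lemma glue_wt: "wt n (glue \<pi> \<rho>) = wt (Suc n) \<pi> + wt n \<rho>"
  using max_split.wt_split[OF glue_max_split, of n] wt_map[OF glue_map_strict_mono] \<rho>
  by (simp add: glue_def)

lemma glue_bad: "bad (glue \<pi> \<rho>) \<longleftrightarrow> bad \<pi> \<or> bad \<rho>"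
  using max_split.bad_split[OF glue_max_split] bad_map[OF glue_map_strict_mono] \<rho>
  by (simp add: glue_def)

lemma glue_is_perm: "is_perm (glue \<pi> \<rho>)"
proof (rule is_permI)
  show "distinct (glue \<pi> \<rho>)"
    using max_split.dist[OF glue_max_split] by (simp add: glue_def)
  have "x \<in> {1..length (glue \<pi> \<rho>)}" if x: "x \<in> set (glue \<pi> \<rho>)" for x
  proof -
    have len: "length \<rho> > 0" "length (glue \<pi> \<rho>) = length \<pi> + length \<rho>"
      using \<rho> by (auto simp: glue_def)
    consider i where "i \<in> set \<pi>" "x = glue_map \<rho> i" | "x = length \<pi> + length \<rho>" | "x \<in> set (tl \<rho>)"
      using x unfolding glue_def set_append set_map list.set by blast
    then show ?thesis
    proof cases
      case 1
      then show ?thesis using \<pi>(1) hd_in len by (auto simp: is_perm_def glue_map_def)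
    next
      case 2
      then show ?thesis using len unfolding atLeastAtMost_iff by linarith
    next
      case 3
      then have "x \<in> set \<rho>" using \<rho>(2) by (simp add: list.set_sel(2))
      then show ?thesis using \<rho>(1) len by (auto simp: is_perm_def)
    qed
  qed
  then show "set (glue \<pi> \<rho>) \<subseteq> {1..length (glue \<pi> \<rho>)}"
    by blast
qed

end

text \<open>The maximum marks the cut, so both sides of it can be read off, and with them the two
  lengths.\<close>

lemma glue_inject:
  assumes \<pi>: "is_perm \<pi>" "\<pi> \<noteq> []" and \<rho>: "is_perm \<rho>" "\<rho> \<noteq> []"
    and \<pi>': "is_perm \<pi>'" "\<pi>' \<noteq> []" and \<rho>': "is_perm \<rho>'" "\<rho>' \<noteq> []"
    and eq: "glue \<pi> \<rho> = glue \<pi>' \<rho>'"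
  shows "\<pi> = \<pi>' \<and> \<rho> = \<rho>'"
proof -
  interpret A: max_split "map (glue_map \<rho>) \<pi>" "tl \<rho>" "length \<pi> + length \<rho>" "hd \<rho>"
    using glue_max_split[OF \<pi> \<rho>] .
  interpret B: max_split "map (glue_map \<rho>') \<pi>'" "tl \<rho>'" "length \<pi>' + length \<rho>'" "hd \<rho>'"
    using glue_max_split[OF \<pi>' \<rho>'] .
  have N_notin: "length \<pi> + length \<rho> \<notin> set (map (glue_map \<rho>) \<pi>)"
      "length \<pi> + length \<rho> \<notin> set (tl \<rho>)"
    using A.dist by auto
  have "length \<pi> + length \<rho> = length \<pi>' + length \<rho>'"
    using arg_cong[OF eq, of length] \<rho> \<rho>' by (simp add: glue_def)
  moreover from this have "map (glue_map \<rho>) \<pi> = map (glue_map \<rho>') \<pi>' \<and> tl \<rho> = tl \<rho>'"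
    using eq by (intro append_Cons_eq_iff[OF N_notin, THEN iffD1]) (simp add: glue_def)
  ultimately have maps: "map (glue_map \<rho>) \<pi> = map (glue_map \<rho>') \<pi>'" and tl: "tl \<rho> = tl \<rho>'"
    and len: "length \<rho> = length \<rho>'"
    by (auto dest: map_eq_imp_length_eq)
  \<comment> \<open>The first entry of \<open>\<rho>\<close> is the one value of
    \<open>{1..length \<rho>}\<close> missing from \<open>tl \<rho>\<close>.\<close>
  have "insert (hd \<rho>) (set (tl \<rho>)) = insert (hd \<rho>') (set (tl \<rho>'))"
    using \<rho> \<rho>' len unfolding is_perm_def by (metis list.collapse list.simps(15))
  moreover have "hd \<rho> \<notin> set (tl \<rho>)" "hd \<rho>' \<notin> set (tl \<rho>')"
    using \<rho> \<rho>' unfolding is_perm_def by (metis distinct.simps(2) list.collapse)+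
  ultimately have "hd \<rho> = hd \<rho>'"
    using tl by auto
  then have "\<rho> = \<rho>'"
    using tl \<rho> \<rho>' by (metis list.collapse)
  moreover have "set \<pi> = set \<pi>'"
    using \<pi> \<pi>' map_eq_imp_length_eq[OF maps] by (simp add: is_perm_def)
  ultimately show ?thesis
    using maps strict_mono_on_imp_inj_on[OF glue_map_strict_mono[OF \<pi> \<rho>]]
    by (auto simp: inj_on_map_eq_map)
qed

section \<open>Decomposition of avoiders\<close>

lemma initial_segment:
  fixes Y :: "nat set"
  assumes "finite Y" "0 \<notin> Y" "\<And>y. y \<in> Y \<Longrightarrow> {1..y} \<subseteq> Y"
  shows "Y = {1..card Y}"
proof (cases "Y = {}")
  case False
  have "Y = {1..Max Y}"
    using assms Max_ge[OF assms(1)] Max_in[OF assms(1) False]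
    by (auto simp: Suc_le_eq) (metis gr0I)
  then show ?thesis by (metis card_atLeastAtMost diff_Suc_1)
qed simp

lemma avoiders_glue_exists:
  assumes "\<tau> = L @ N # Q" "\<tau> \<in> avoiders" "N = length \<tau>" "L \<noteq> []"
  shows "\<exists>\<pi>\<in>avoiders. \<exists>\<rho>\<in>avoiders. \<tau> = glue \<pi> \<rho>"
proof -
  define a where "a = Min (set L)"
  have a: "a \<in> set L" "\<And>x. x \<in> set L \<Longrightarrow> a \<le> x"
    using assms(4) by (auto simp: a_def)
  have perm: "is_perm \<tau>" and nb: "\<not> bad \<tau>"
    using assms(2) by (auto simp: avoiders_def)
  have dist: "distinct (L @ N # Q)" and set_\<tau>: "set (L @ N # Q) = {1..N}"
    using perm unfolding assms(1)[symmetric] unfolding is_perm_def assms(3) by blast+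
  have bounds: "1 \<le> x" "x < N" if "x \<in> set L \<union> set Q" for x
  proof -
    have "x \<in> {1..N}" using that set_\<tau> by auto
    moreover have "x \<noteq> N" using that dist by auto
    ultimately show "1 \<le> x" "x < N" by auto
  qed
  \<comment> \<open>If some \<open>x\<close> other than the minimum \<open>a\<close> were below
    \<open>y\<close>, then \<open>a\<close> and \<open>x\<close>, in whichever order they occur,
    followed by \<open>N\<close> and \<open>y\<close> would be bad.\<close>
  have Q_less_L: "y < x" if x: "x \<in> set L" "x \<noteq> a" and "y \<in> set Q" for x y
  proof (rule ccontr)
    assume "\<not> y < x"
    moreover have "x \<noteq> y" using that dist by auto
    ultimately have xy: "x < y" by simp
    have NQ: "subseq [N, y] (N # Q)"
      using that by (simp add: subseq_singleton_left)
    obtain L1 L2 where L: "L = L1 @ a # L2"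
      using split_list[OF a(1)] by blast
    then consider "x \<in> set L1" | "x \<in> set L2"
      using x by auto
    then have "subseq [x, a] L \<or> subseq [a, x] L"
    proof cases
      case 1
      then have "subseq ([x] @ [a]) (L1 @ a # L2)"
        by (intro list_emb_append_mono) (auto simp: subseq_singleton_left)
      then show ?thesis using L by simp
    next
      case 2
      then have "subseq [a, x] (a # L2)" by (simp add: subseq_singleton_left)
      then show ?thesis using L by (simp add: subseq_drop_many)
    qed
    then have "subseq ([x, a] @ [N, y]) (L @ N # Q) \<or> subseq ([a, x] @ [N, y]) (L @ N # Q)"
      using list_emb_append_mono NQ by metis
    moreover have "a < y" "y < N"
      using a(2)[OF that(1)] xy bounds that by auto
    ultimately have "bad \<tau>"
      using xy assms(1) unfolding bad_def append_Cons append_Nil by blast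
    then show False using nb by simp
  qed
  interpret max_split L Q N a
  proof (unfold_locales, rule dist, rule a(1))
    fix x y
    show "x < N" if "x \<in> set L" using that bounds(2) by simp
    show "y < N" if "y \<in> set Q" using that bounds(2) by simp
    show "y < x" if "x \<in> set L" "x \<noteq> a" "y \<in> set Q" using that by (rule Q_less_L)
  qed
  have lens: "N = length L + length (a # Q)"
    using arg_cong[OF assms(1), of length] assms(3) by simp
  have dist_aQ: "distinct (a # Q)"
    using distinct_subseq[OF subseq_a_Q dist] .
  have set_aQ: "set (a # Q) = {1..length (a # Q)}"
  proof -
    \<comment> \<open>Entries of \<open>L\<close> other than \<open>a\<close> exceed
      \<open>a\<close> and all of \<open>Q\<close>, so every value below an entry of
      \<open>a # Q\<close> is again in \<open>a # Q\<close>.\<close>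
    have down: "{1..y} \<subseteq> set (a # Q)" if "y \<in> set (a # Q)" for y
    proof
      fix z assume z: "z \<in> {1..y}"
      have "y < N" using that bounds a(1) by auto
      with z have "z \<in> set (L @ N # Q)" "z \<noteq> N" unfolding set_\<tau> by auto
      then have "z \<in> set L \<union> set Q" by simp
      moreover have "z = a" if "z \<in> set L"
      proof (rule ccontr)
        assume "z \<noteq> a"
        then have "y < z"
          using Q_less_L[OF that, of y] a(2)[OF that] \<open>y \<in> set (a # Q)\<close> by auto
        then show False using z by simp
      qed
      ultimately show "z \<in> set (a # Q)" by auto
    qed
    have "0 \<notin> set (a # Q)" using bounds a(1) by force
    then show ?thesis
      using initial_segment[OF finite_set _ down] unfolding distinct_card[OF dist_aQ] by blast
  qed
  have big: "length (a # Q) < x" if "x \<in> set L" "x \<noteq> a" for x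
  proof -
    have "x \<notin> set (a # Q)" using that dist by auto
    moreover have "1 \<le> x" using bounds(1) that(1) by simp
    ultimately show ?thesis unfolding set_aQ by simp
  qed
  \<comment> \<open>The inverse of \<open>glue_map (a # Q)\<close> on \<open>L\<close>; the shift is
    \<open>length (a # Q) - 1\<close>, that is \<open>length Q\<close>.\<close>
  define g where "g x = (if x = a then 1 else x - length Q)" for x
  have glue_g: "glue_map (a # Q) (g x) = x" if "x \<in> set L" for x
    using big[OF that] by (auto simp: glue_map_def g_def)
  have perm_\<rho>: "is_perm (a # Q)"
    using dist_aQ set_aQ by (simp add: is_perm_def)
  have perm_\<pi>: "is_perm (map g L)"
  proof (rule is_permI)
    show "distinct (map g L)"
      using dist inj_on_inverseI[of "set L" "glue_map (a # Q)" g] glue_g by (simp add: distinct_map)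
    have "g x \<in> {1..length L}" if "x \<in> set L" for x
      using that big[of x] bounds[of x] lens assms(4) by (cases "x = a") (auto simp: g_def Suc_le_eq)
    then show "set (map g L) \<subseteq> {1..length (map g L)}"
      by auto
  qed
  have \<tau>: "\<tau> = glue (map g L) (a # Q)"
    using glue_g lens by (simp add: glue_def assms(1) map_idI)
  show ?thesis
    using nb \<tau> glue_bad[OF perm_\<pi> _ perm_\<rho>] perm_\<pi> perm_\<rho> assms(4)
    by (intro bexI[of _ "map g L"] bexI[of _ "a # Q"]) (auto simp: avoiders_def)
qed

lemma bad_Cons_max_iff: "is_perm \<pi> \<Longrightarrow> bad (Suc (length \<pi>) # \<pi>) \<longleftrightarrow> bad \<pi>"
  by (rule bad_Cons_max) (auto simp: is_perm_def)

lemma wt_Cons_max_eq: "is_perm \<pi> \<Longrightarrow> wt n (Suc (length \<pi>) # \<pi>) = shift_exp n 1 + wt n \<pi>"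
  by (rule wt_Cons_max) (auto simp: is_perm_def)

lemma singleton_avoider: "[1] \<in> avoiders"
  by (auto simp: avoiders_def is_perm_def bad_def)

text \<open>Cut at the maximum: both sides empty, only the left side empty, or the left side
  nonempty.\<close>

lemma avoiders_decompose:
  "avoiders = {[1]} \<union> (\<lambda>\<pi>. Suc (length \<pi>) # \<pi>) ` avoiders \<union> case_prod glue ` (avoiders \<times> avoiders)"
    (is "_ = ?R")
proof (intro equalityI subsetI)
  fix \<tau> assume \<tau>: "\<tau> \<in> avoiders"
  then have "length \<tau> \<in> set \<tau>"
    by (auto simp: avoiders_def is_perm_def Suc_le_eq)
  then obtain L Q where split: "\<tau> = L @ length \<tau> # Q"
    by (meson split_list)
  show "\<tau> \<in> ?R"
  proof (cases "L = []")
    case True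
    then have \<tau>_eq: "\<tau> = Suc (length Q) # Q"
      using split by (metis append_Nil length_Cons)
    then have "is_perm Q" "\<not> bad Q"
      using \<tau> is_perm_Cons_max[of Q] bad_Cons_max_iff[of Q] by (auto simp: avoiders_def)
    then show ?thesis
      using \<tau>_eq by (cases "Q = []") (auto simp: avoiders_def)
  next
    case False
    then show ?thesis
      using avoiders_glue_exists[OF split \<tau> refl] by auto
  qed
next
  fix \<tau> assume "\<tau> \<in> ?R"
  then consider "\<tau> = [1]" | \<pi> where "\<pi> \<in> avoiders" "\<tau> = Suc (length \<pi>) # \<pi>"
    | \<pi> \<rho> where "\<pi> \<in> avoiders" "\<rho> \<in> avoiders" "\<tau> = glue \<pi> \<rho>"
    by (elim UnE imageE) auto
  then show "\<tau> \<in> avoiders"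
  proof cases
    case 1
    then show ?thesis using singleton_avoider by simp
  next
    case 2
    then show ?thesis using is_perm_Cons_max bad_Cons_max_iff by (simp add: avoiders_def)
  next
    case 3
    then show ?thesis using glue_is_perm[of \<pi> \<rho>] glue_bad[of \<pi> \<rho>] by (simp add: avoiders_def glue_def)
  qed
qed

section \<open>Counting avoiders by weight\<close>

lemma wt_singleton: "wt n [1] = shift_exp n 1"
  using wt_Cons_max_eq[of "[]" n] by (simp add: is_perm_def wt_def incs_Nil)

lemma mexp_conv_shift_exp: "mexp n = shift_exp n 1"
  by (simp add: mexp_def shift_exp_def)

lemma mps_mult_mser: "mps_mult (mser n) f e = (\<Sum>b\<in>{b. mexp n + b = e}. f b)"
proof -
  have "mps_mult (mser n) f e = (\<Sum>(a, b)\<in>{(a, b). a = mexp n \<and> a + b = e}. mser n a * f b)"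
    unfolding mps_mult_def
    by (rule sum.mono_neutral_right) (auto simp: finite_splittings mser_def mps_monom_def split: if_splits)
  also have "\<dots> = (\<Sum>b\<in>{b. mexp n + b = e}. f b)"
    by (rule sum.reindex_bij_witness[of _ "Pair (mexp n)" snd]) (auto simp: mser_def mps_monom_def)
  finally show ?thesis .
qed

text \<open>Pairs are grouped by the weights of their two components, which run through the
  splittings of \<open>e\<close>.\<close>

lemma card_glue:
  "int (card {(\<pi>, \<rho>). \<pi> \<in> avoiders \<and> \<rho> \<in> avoiders \<and> wt (Suc n) \<pi> + wt n \<rho> = e}) =
    mps_mult (avoider_series (Suc n)) (avoider_series n) e"
proof -
  let ?A = "\<lambda>n e. {\<pi> \<in> avoiders. wt n \<pi> = e}"
  have "{(\<pi>, \<rho>). \<pi> \<in> avoiders \<and> \<rho> \<in> avoiders \<and> wt (Suc n) \<pi> + wt n \<rho> = e} =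
      (\<Union>p\<in>{(a, b). a + b = e}. ?A (Suc n) (fst p) \<times> ?A n (snd p))"
    by auto
  also have "card \<dots> = (\<Sum>p\<in>{(a, b). a + b = e}. card (?A (Suc n) (fst p) \<times> ?A n (snd p)))"
    by (rule card_UN_disjoint) (auto simp: finite_splittings intro!: finite_avoiders_wt finite_cartesian_product)
  finally show ?thesis
    by (simp add: mps_mult_def avoider_series_def card_cartesian_product case_prod_unfold)
qed

lemma card_Cons_max:
  "int (card {\<pi> \<in> avoiders. shift_exp n 1 + wt n \<pi> = e}) = mps_mult (mser n) (avoider_series n) e"
\<comment> \<open>By cancellation at most one \<open>b\<close> completes
  \<open>shift_exp n 1\<close> to \<open>e\<close>; if there is none, both sides are 0.\<close>
proof (cases "\<exists>b. shift_exp n 1 + b = e")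
  case True
  then obtain b where "shift_exp n 1 + b = e" by blast
  then have "{b. mexp n + b = e} = {b}" "{\<pi> \<in> avoiders. shift_exp n 1 + wt n \<pi> = e} = {\<pi> \<in> avoiders. wt n \<pi> = b}"
    by (auto simp: mexp_conv_shift_exp)
  then show ?thesis by (simp add: mps_mult_mser avoider_series_def)
next
  case False
  then show ?thesis by (simp add: mps_mult_mser mexp_conv_shift_exp)
qed

text \<open>The three families of \<open>avoiders_decompose\<close> contribute m_n, m_n F n and F (n
  + 1) F n.\<close>

lemma avoider_series_unfold:
  "avoider_series n = mps_add (mser n)
    (mps_mult (mps_add (mser n) (avoider_series (Suc n))) (avoider_series n))"
proof
  fix e
  let ?c = "\<lambda>\<pi>::nat list. Suc (length \<pi>) # \<pi>"
  let ?S = "if shift_exp n 1 = e then {[1::nat]} else {}"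
  let ?C = "{\<pi> \<in> avoiders. shift_exp n 1 + wt n \<pi> = e}"
  let ?G = "{(\<pi>, \<rho>). \<pi> \<in> avoiders \<and> \<rho> \<in> avoiders \<and> wt (Suc n) \<pi> + wt n \<rho> = e}"
  have perm: "is_perm \<pi>" "\<pi> \<noteq> []" if "\<pi> \<in> avoiders" for \<pi>
    using that by (auto simp: avoiders_def)
  have decomp: "{\<tau> \<in> avoiders. wt n \<tau> = e} = ?S \<union> ?c ` ?C \<union> case_prod glue ` ?G"
    by (subst avoiders_decompose) (auto simp: wt_singleton[unfolded One_nat_def] wt_Cons_max_eq glue_wt perm image_iff)
  have "?S \<inter> ?c ` ?C = {}"
    using perm by auto
  moreover have "(?S \<union> ?c ` ?C) \<inter> case_prod glue ` ?G = {}"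
  proof -
    have "glue \<pi> \<rho> \<notin> ?S \<union> ?c ` ?C" if "\<pi> \<in> avoiders" "\<rho> \<in> avoiders" for \<pi> \<rho>
    proof -
      interpret max_split "map (glue_map \<rho>) \<pi>" "tl \<rho>" "length \<pi> + length \<rho>" "hd \<rho>"
        using glue_max_split perm that by blast
      have len: "length (glue \<pi> \<rho>) = length \<pi> + length \<rho>" "length \<pi> > 0" "length \<rho> > 0"
        using perm that by (auto simp: glue_def)
      \<comment> \<open>A glued permutation starts inside its nonempty left part, hence below its
        maximum; the other two families start with the maximum.\<close>
      have hd: "hd (glue \<pi> \<rho>) < length (glue \<pi> \<rho>)"
        using L_less[of "glue_map \<rho> (hd \<pi>)"] perm(2)[OF that(1)] len(1)
        by (simp add: glue_def hd_append hd_map)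
      have "glue \<pi> \<rho> \<notin> ?S"
        using len by (cases "glue \<pi> \<rho> = [1]") auto
      moreover have "glue \<pi> \<rho> \<noteq> ?c \<sigma>" for \<sigma>
        using hd by (metis length_Cons less_irrefl list.sel(1))
      ultimately show ?thesis by blast
    qed
    then have notin: "case_prod glue p \<notin> ?S \<union> ?c ` ?C" if "p \<in> ?G" for p
      using that unfolding mem_Collect_eq by (cases p) (simp only: case_prod_conv not_False_eq_True)
    show ?thesis
    proof (rule equals0I, elim IntE imageE)
      fix \<tau> p assume "\<tau> \<in> ?S \<union> ?c ` ?C" "p \<in> ?G" "\<tau> = case_prod glue p"
      then show False using notin[of p] by (simp only:)
    qed
  qed
  moreover have "finite (?S \<union> ?c ` ?C \<union> case_prod glue ` ?G)"
    using finite_avoiders_wt[of n e] unfolding decomp .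
  ultimately have "card {\<tau> \<in> avoiders. wt n \<tau> = e} =
      card ?S + card (?c ` ?C) + card (case_prod glue ` ?G)"
    unfolding decomp by (simp only: card_Un_disjoint finite_Un)
  moreover have "card (?c ` ?C) = card ?C"
    by (rule card_image) (auto simp: inj_on_def)
  moreover have "card (case_prod glue ` ?G) = card ?G"
  proof (rule card_image, rule inj_onI, clarify)
    fix \<pi> \<rho> \<pi>' \<rho>'
    assume "\<pi> \<in> avoiders" "\<rho> \<in> avoiders" "\<pi>' \<in> avoiders" "\<rho>' \<in> avoiders" "glue \<pi> \<rho> = glue \<pi>' \<rho>'"
    then show "\<pi> = \<pi>' \<and> \<rho> = \<rho>'"
      by (intro glue_inject perm)
  qed
  moreover have "int (card ?S) = mser n e"
    by (simp add: mser_def mps_monom_def mexp_conv_shift_exp)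
  ultimately show "avoider_series n e = mps_add (mser n)
      (mps_mult (mps_add (mser n) (avoider_series (Suc n))) (avoider_series n)) e"
    by (simp add: avoider_series_def[of n e] mps_mult_add_left mps_add_def card_glue card_Cons_max
        del: One_nat_def)
qed

text \<open>Equality with the infinite fraction is x_1-adic convergence: for each \<open>D\<close>,
  all coefficients of x_1-degree below \<open>D\<close> are eventually exact.\<close>

theorem mainTheorem1:
  "\<forall>D. \<exists>N. \<forall>d\<ge>N. \<forall>e. Poly_Mapping.lookup e 1 < D \<longrightarrow> cf_approx d e = lhs_series e"
proof (intro allI exI impI)
  fix D d :: nat and e :: mono
  \<comment> \<open>The witness for the depth bound, left open by \<open>exI\<close>, is
    \<open>D\<close> itself.\<close>
  assume "D \<le> d" "Poly_Mapping.lookup e 1 < D"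
  then have "cf_tail d 0 e = avoider_series 0 e"
    by (intro cf_tail_eq_solution avoider_series_unfold avoider_series_eq_0) auto
  then show "cf_approx d e = lhs_series e"
    by (simp add: cf_approx_def lhs_series_eq mps_add_def)
qed

end
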